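(* Let $C$ be a candidate execution that is well-formed, valid in the revised JavaScript memory model, and data-race-free (no two distinct events of $C$ form a data race). Then $C$ is sequentially consistent.
   Context: **Events.** An event $E$ has a mode $E.\mathrm{ord}\in\{\mathrm{Unordered},\mathrm{SeqCst},\mathrm{Init}\}$, a block address $E.\mathrm{block}$, a natural number $E.\mathrm{index}$, byte lists $E.\mathrm{reads}$ and $E.\mathrm{writes}$, and a boolean $E.\mathrm{tearfree}$. Put $\mathrm{range}_r(E)=[E.\mathrm{index},E.\mathrm{index}+|E.\mathrm{reads}|)$, $\mathrm{range}_w(E)=[E.\mathrm{index},E.\mathrm{index}+|E.\mathrm{writes}|)$, $\mathrm{range}(E)=\mathrm{range}_r(E)\cup\mathrm{range}_w(E)$ (sets of natural numbers; an empty list gives the empty range). $\mathrm{write}(E)$ means $E.\mathrm{writes}\neq[\,]$. $\mathrm{overlap}(A,B)$ means $A.\mathrm{block}=B.\mathrm{block}$ and $\mathrm{range}(A)\cap\mathrm{range}(B)\ne\emptyset$. All events of a candidate execution are assumed to have the same block (a single shared buffer). **Candidate execution.** A set of events $\mathrm{evs}$ with binary relations $\mathrm{sb}$ (sequenced-before), $\mathrm{asw}$ (additional-synchronizes-with), $\mathrm{tot}$ (total-order) on $\mathrm{evs}$ and a set $\mathrm{rbf}$ (reads-byte-from) of triples $(k,E_w,E_r)\in\mathbb N\times\mathrm{evs}\times\mathrm{evs}$. **Well-formed.** (i) Every event has $\mathrm{reads}$ or $\mathrm{writes}$ nonempty; if both are nonempty (a read-modify-write) they have equal length and the mode is SeqCst.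 (ii) There is exactly one event of mode Init; it has empty $\mathrm{reads}$, its range contains the range of every event, and it is not related by $\mathrm{sb}$ or $\mathrm{asw}$ to anything. (iii) $\mathrm{sb}$ is a strict partial order that is the disjoint union of strict total orders, one on the non-Init events of each thread. (iv) If $(k,E_w,E_r)\in\mathrm{rbf}$ then $E_w\neq E_r$, $k\in\mathrm{range}_w(E_w)\cap\mathrm{range}_r(E_r)$, and the byte written by $E_w$ at $k$ equals the byte read by $E_r$ at $k$; for every $E_r$ and $k\in\mathrm{range}_r(E_r)$ there is exactly one $E_w$ with $(k,E_w,E_r)\in\mathrm{rbf}$. (v) $\mathrm{tot}$ is a strict total order on $\mathrm{evs}$. **Derived relations (revised model).** $A\ \mathrm{rf}\ B$ iff $\exists k.\ (k,A,B)\in\mathrm{rbf}$. $\mathrm{sw}=\{(A,B): A\ \mathrm{rf}\ B,\ \mathrm{range}_w(A)=\mathrm{range}_r(B),\ A.\mathrm{ord}=B.\mathrm{ord}=\mathrm{SeqCst}\}\cup\mathrm{asw}$. $\mathrm{hb}=(\mathrm{sb}\cup\mathrm{sw}\cup\{(A,B): A.\mathrm{ord}=\mathrm{Init},\ B.\mathrm{ord}\neq\mathrm{Init},\ \mathrm{overlap}(A,B)\})^+$. **Valid in the revised model** means all of the following hold. (HB1) $\mathrm{hb}\subseteq\mathrm{tot}$. (HB2) If $E_w\ \mathrm{rf}\ E_r$ then not $E_r\ \mathrm{hb}\ E_w$. (HB3) For $(k,E_w,E_r)\in\mathrm{rbf}$ there is no $E'_w$ with $E_w\ \mathrm{hb}\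 E'_w$, $E'_w\ \mathrm{hb}\ E_r$ and $k\in\mathrm{range}_w(E'_w)$. (Tear-Free Reads) For every $E_r$ with $E_r.\mathrm{tearfree}$, there is at most one $E_w$ with $E_w\ \mathrm{rf}\ E_r$, $E_w.\mathrm{tearfree}$ and $\mathrm{range}_w(E_w)=\mathrm{range}_r(E_r)$. (SC Atomics) If $E_w\ \mathrm{rf}\ E_r$ and $E_w\ \mathrm{hb}\ E_r$, then there is no $E'_w$ with $E'_w.\mathrm{ord}=\mathrm{SeqCst}$, $E_w\ \mathrm{tot}\ E'_w$, $E'_w\ \mathrm{tot}\ E_r$ satisfying at least one of: (a) $\mathrm{range}_w(E'_w)=\mathrm{range}_r(E_r)$ and $E_w\ \mathrm{sw}\ E_r$; (b) $\mathrm{range}_w(E_w)=\mathrm{range}_w(E'_w)$, $E_w.\mathrm{ord}=\mathrm{SeqCst}$ and $E'_w\ \mathrm{hb}\ E_r$; (c) $\mathrm{range}_w(E'_w)=\mathrm{range}_r(E_r)$, $E_w\ \mathrm{hb}\ E'_w$ and $E_r.\mathrm{ord}=\mathrm{SeqCst}$. (Primed write variables range over events with nonempty $\mathrm{writes}$.) **Data race.** Distinct events $A,B$ form a data race if ($A.\mathrm{ord}=\mathrm{Unordered}$ or $B.\mathrm{ord}=\mathrm{Unordered}$ or $\mathrm{range}(A)\ne\mathrm{range}(B)$), $\mathrm{overlap}(A,B)$, ($\mathrm{write}(A)$ or $\mathrm{write}(B)$), and neither $A\ \mathrm{hb}\ B$ nor $B\ \mathrm{hb}\ A$. **Sequentially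 consistent.** There is a strict total order $<$ on $\mathrm{evs}$ (a sequential interleaving) with $\mathrm{sb}\cup\mathrm{asw}\subseteq\,<$ such that every byte is read from the most recent write: for each $(k,E_w,E_r)\in\mathrm{rbf}$, $E_w<E_r$ and there is no event $E'_w$ with $E_w<E'_w<E_r$ and $k\in\mathrm{range}_w(E'_w)$. *)

theory Defs
  imports "HOL-Library.Word" "HOL-Library.Disjoint_Sets"
begin

datatype mode = Unordered | SeqCst | Init

(* ident plays no role in the model; it keeps events with the same attributes apart, e.g. two
   reads by one thread of the same value at the same location. *)
record ('i, 'b) event =
  ident :: 'i
  ord :: mode
  block :: 'b
  index :: nat
  reads :: "8 word list"
  writes :: "8 word list"
  tearfree :: bool

definition range_r :: "('i, 'b) event \<Rightarrow> nat set" where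
  "range_r E = {index E ..< index E + length (reads E)}"

definition range_w :: "('i, 'b) event \<Rightarrow> nat set" where
  "range_w E = {index E ..< index E + length (writes E)}"

definition range_ev :: "('i, 'b) event \<Rightarrow> nat set" where
  "range_ev E = range_r E \<union> range_w E"

definition is_write :: "('i, 'b) event \<Rightarrow> bool" where
  "is_write E \<longleftrightarrow> writes E \<noteq> []"

definition overlap :: "('i, 'b) event \<Rightarrow> ('i, 'b) event \<Rightarrow> bool" where
  "overlap A B \<longleftrightarrow> block A = block B \<and> range_ev A \<inter> range_ev B \<noteq> {}"

(* Byte positions k are absolute positions in the block, whereas the byte lists of an event start
   at its index; these are only meaningful for k in range_w E and range_r E respectively. *)
definition written_byte :: "('i, 'b) event \<Rightarrow> nat \<Rightarrow> 8 word" where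
  "written_byte E k = writes E ! (k - index E)"

definition read_byte :: "('i, 'b) event \<Rightarrow> nat \<Rightarrow> 8 word" where
  "read_byte E k = reads E ! (k - index E)"

record ('i, 'b) candidate =
  evs :: "('i, 'b) event set"
  sb :: "('i, 'b) event rel"
  asw :: "('i, 'b) event rel"
  tot :: "('i, 'b) event rel"
  rbf :: "(nat \<times> ('i, 'b) event \<times> ('i, 'b) event) set"

definition candidate_execution :: "('i, 'b) candidate \<Rightarrow> bool" where
  "candidate_execution C \<longleftrightarrow>
     sb C \<subseteq> evs C \<times> evs C \<and>
     asw C \<subseteq> evs C \<times> evs C \<and>
     tot C \<subseteq> evs C \<times> evs C \<and>
     rbf C \<subseteq> UNIV \<times> evs C \<times> evs C \<and>
     (\<forall>A\<in>evs C. \<forall>B\<in>evs C. block A = block B)"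

definition strict_total_order :: "'a set \<Rightarrow> 'a rel \<Rightarrow> bool" where
  "strict_total_order X r \<longleftrightarrow> r \<subseteq> X \<times> X \<and> strict_linear_order_on X r"

definition wf_events :: "('i, 'b) candidate \<Rightarrow> bool" where
  "wf_events C \<longleftrightarrow>
     (\<forall>E\<in>evs C.
        (reads E \<noteq> [] \<or> writes E \<noteq> []) \<and>
        (reads E \<noteq> [] \<and> writes E \<noteq> [] \<longrightarrow>
           length (reads E) = length (writes E) \<and> ord E = SeqCst))"

definition wf_init :: "('i, 'b) candidate \<Rightarrow> bool" where
  "wf_init C \<longleftrightarrow>
     (\<exists>!I. I \<in> evs C \<and> ord I = Init) \<and>
     (\<forall>I\<in>evs C. ord I = Init \<longrightarrow>
        reads I = [] \<and>
        (\<forall>E\<in>evs C. range_ev E \<subseteq> range_ev I) \<and>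
        (\<forall>E. (I, E) \<notin> sb C \<union> asw C \<and> (E, I) \<notin> sb C \<union> asw C))"

(* Events carry no thread identifier: the threads are the parts of some partition of the
   non-Init events, and po T is the order on the thread T. *)
definition wf_sb :: "('i, 'b) candidate \<Rightarrow> bool" where
  "wf_sb C \<longleftrightarrow>
     irrefl (sb C) \<and> trans (sb C) \<and>
     (\<exists>threads po.
        partition_on {E \<in> evs C. ord E \<noteq> Init} threads \<and>
        (\<forall>T\<in>threads. strict_total_order T (po T)) \<and>
        sb C = (\<Union>T\<in>threads. po T))"

definition wf_rbf :: "('i, 'b) candidate \<Rightarrow> bool" where
  "wf_rbf C \<longleftrightarrow>
     (\<forall>k Ew Er. (k, Ew, Er) \<in> rbf C \<longrightarrow>
        Ew \<noteq> Er \<and> k \<in> range_w Ew \<inter> range_r Er \<and> written_byte Ew k = read_byte Er k) \<and>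
     (\<forall>Er\<in>evs C. \<forall>k\<in>range_r Er. \<exists>!Ew. (k, Ew, Er) \<in> rbf C)"

definition well_formed :: "('i, 'b) candidate \<Rightarrow> bool" where
  "well_formed C \<longleftrightarrow>
     wf_events C \<and> wf_init C \<and> wf_sb C \<and> wf_rbf C \<and> strict_total_order (evs C) (tot C)"

definition rf :: "('i, 'b) candidate \<Rightarrow> ('i, 'b) event rel" where
  "rf C = {(A, B). \<exists>k. (k, A, B) \<in> rbf C}"

definition sw :: "('i, 'b) candidate \<Rightarrow> ('i, 'b) event rel" where
  "sw C = {(A, B). (A, B) \<in> rf C \<and> range_w A = range_r B \<and> ord A = SeqCst \<and> ord B = SeqCst}
          \<union> asw C"

definition hb :: "('i, 'b) candidate \<Rightarrow> ('i, 'b) event rel" where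
  "hb C = (sb C \<union> sw C \<union>
     {(A, B). A \<in> evs C \<and> B \<in> evs C \<and> ord A = Init \<and> ord B \<noteq> Init \<and> overlap A B})\<^sup>+"

definition HB1 :: "('i, 'b) candidate \<Rightarrow> bool" where
  "HB1 C \<longleftrightarrow> hb C \<subseteq> tot C"

definition HB2 :: "('i, 'b) candidate \<Rightarrow> bool" where
  "HB2 C \<longleftrightarrow> (\<forall>Ew Er. (Ew, Er) \<in> rf C \<longrightarrow> (Er, Ew) \<notin> hb C)"

definition HB3 :: "('i, 'b) candidate \<Rightarrow> bool" where
  "HB3 C \<longleftrightarrow>
     (\<forall>k Ew Er. (k, Ew, Er) \<in> rbf C \<longrightarrow>
        \<not> (\<exists>Ew'\<in>evs C. is_write Ew' \<and>
             (Ew, Ew') \<in> hb C \<and> (Ew', Er) \<in> hb C \<and> k \<in> range_w Ew'))"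

definition tear_free_reads :: "('i, 'b) candidate \<Rightarrow> bool" where
  "tear_free_reads C \<longleftrightarrow>
     (\<forall>Er\<in>evs C. tearfree Er \<longrightarrow>
        (\<exists>\<^sub>\<le>\<^sub>1 Ew. (Ew, Er) \<in> rf C \<and> tearfree Ew \<and> range_w Ew = range_r Er))"

definition sc_atomics :: "('i, 'b) candidate \<Rightarrow> bool" where
  "sc_atomics C \<longleftrightarrow>
     (\<forall>Ew Er. (Ew, Er) \<in> rf C \<and> (Ew, Er) \<in> hb C \<longrightarrow>
        \<not> (\<exists>Ew'\<in>evs C. is_write Ew' \<and> ord Ew' = SeqCst \<and>
             (Ew, Ew') \<in> tot C \<and> (Ew', Er) \<in> tot C \<and>
             ((range_w Ew' = range_r Er \<and> (Ew, Er) \<in> sw C) \<or>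
              (range_w Ew = range_w Ew' \<and> ord Ew = SeqCst \<and> (Ew', Er) \<in> hb C) \<or>
              (range_w Ew' = range_r Er \<and> (Ew, Ew') \<in> hb C \<and> ord Er = SeqCst))))"

definition valid_revised :: "('i, 'b) candidate \<Rightarrow> bool" where
  "valid_revised C \<longleftrightarrow> HB1 C \<and> HB2 C \<and> HB3 C \<and> tear_free_reads C \<and> sc_atomics C"

definition data_race :: "('i, 'b) candidate \<Rightarrow> ('i, 'b) event \<Rightarrow> ('i, 'b) event \<Rightarrow> bool" where
  "data_race C A B \<longleftrightarrow>
     A \<noteq> B \<and>
     (ord A = Unordered \<or> ord B = Unordered \<or> range_ev A \<noteq> range_ev B) \<and>
     overlap A B \<and> (is_write A \<or> is_write B) \<and>
     (A, B) \<notin> hb C \<and> (B, A) \<notin> hb C"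

definition data_race_free :: "('i, 'b) candidate \<Rightarrow> bool" where
  "data_race_free C \<longleftrightarrow> \<not> (\<exists>A\<in>evs C. \<exists>B\<in>evs C. data_race C A B)"

definition sequentially_consistent :: "('i, 'b) candidate \<Rightarrow> bool" where
  "sequentially_consistent C \<longleftrightarrow>
     (\<exists>lt. strict_total_order (evs C) lt \<and> sb C \<union> asw C \<subseteq> lt \<and>
        (\<forall>k Ew Er. (k, Ew, Er) \<in> rbf C \<longrightarrow>
           (Ew, Er) \<in> lt \<and>
           \<not> (\<exists>Ew'\<in>evs C. (Ew, Ew') \<in> lt \<and> (Ew', Er) \<in> lt \<and> k \<in> range_w Ew')))"

end

(* The given total order tot is itself the sequential interleaving. In a race-free execution two
   distinct events that share a byte, one of them a write, are either hb-ordered or both SeqCst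
   with equal ranges. Hence rf is contained in hb: an unordered rf pair would synchronize. If Ew'
   overwrites the byte strictly between Ew and Er in tot, then HB3 excludes that Ew' is hb-ordered
   with both, and the clauses of SC Atomics exclude the rest: (c) if only (Ew, Ew') is hb-ordered,
   (b) if only (Ew', Er) is, and (a) if neither is. *)
theory Submission
  imports Defs
begin

text \<open>A well-formed read-modify-write has lists of equal length, and an empty list contributes
  an empty range. This converts the \<open>range_ev\<close> equalities supplied by race freedom into
  the \<open>range_w\<close> and \<open>range_r\<close> equalities required by \<open>sw\<close> and
  SC Atomics.\<close>

lemma range_w_eq_range_ev:
  assumes "wf_events C" "E \<in> evs C" "k \<in> range_w E"
  shows "range_w E = range_ev E"
proof -
  have "writes E \<noteq> []"
    using assms(3) by (auto simp: range_w_def)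
  then show ?thesis
    using assms(1,2) by (cases "reads E = []") (auto simp: wf_events_def range_ev_def range_r_def range_w_def)
qed

lemma range_r_eq_range_ev:
  assumes "wf_events C" "E \<in> evs C" "k \<in> range_r E"
  shows "range_r E = range_ev E"
proof -
  have "reads E \<noteq> []"
    using assms(3) by (auto simp: range_r_def)
  then show ?thesis
    using assms(1,2) by (cases "writes E = []") (auto simp: wf_events_def range_ev_def range_r_def range_w_def)
qed

lemma is_write_if_in_range_w: "k \<in> range_w E \<Longrightarrow> is_write E"
  by (auto simp: range_w_def is_write_def)

lemma init_hb:
  assumes "A \<in> evs C" "B \<in> evs C" "ord A = Init" "ord B \<noteq> Init" "overlap A B"
  shows "(A, B) \<in> hb C"
  using assms by (auto simp: hb_def)

lemma sw_subset_hb: "sw C \<subseteq> hb C"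
  by (auto simp: hb_def)

lemma overlapI:
  assumes "candidate_execution C" "A \<in> evs C" "B \<in> evs C" "k \<in> range_ev A" "k \<in> range_ev B"
  shows "overlap A B"
  using assms unfolding candidate_execution_def overlap_def by blast

text \<open>For an hb-unordered pair, race freedom excludes mode \<open>Unordered\<close> and
  unequal ranges. Mode \<open>Init\<close> is excluded as well: the \<open>Init\<close> event is
  unique and happens before every other event that it overlaps.\<close>

lemma conflict_cases:
  assumes "candidate_execution C" "well_formed C" "data_race_free C"
    and "A \<in> evs C" "B \<in> evs C" "A \<noteq> B" "k \<in> range_ev A" "k \<in> range_ev B"
    and "is_write A \<or> is_write B"
  obtains (hb) "(A, B) \<in> hb C \<or> (B, A) \<in> hb C"
    | (SeqCst) "ord A = SeqCst" "ord B = SeqCst" "range_ev A = range_ev B"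
proof (cases "(A, B) \<in> hb C \<or> (B, A) \<in> hb C")
  case False
  have ov: "overlap A B" "overlap B A"
    using overlapI[OF assms(1)] assms(4,5,7,8) by simp_all
  have "ord A \<noteq> Unordered" "ord B \<noteq> Unordered" "range_ev A = range_ev B"
    using assms(3-6,9) False ov(1) by (auto simp: data_race_free_def data_race_def)
  moreover have "ord A \<noteq> Init \<or> ord B \<noteq> Init"
    using assms(2,4-6) unfolding well_formed_def wf_init_def by metis
  then have "ord A \<noteq> Init" "ord B \<noteq> Init"
    using init_hb[of A C B] init_hb[of B C A] ov False assms(4,5) by auto
  ultimately show ?thesis
    by (intro SeqCst) (cases "ord A"; cases "ord B"; simp)+
qed (rule hb)

lemma rbf_hb:
  assumes C: "candidate_execution C" "well_formed C" "data_race_free C" and "HB2 C"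
    and rbf: "(k, Ew, Er) \<in> rbf C"
  shows "(Ew, Er) \<in> hb C"
proof -
  have E: "Ew \<in> evs C" "Er \<in> evs C"
    using C(1) rbf unfolding candidate_execution_def by blast+
  have wfe: "wf_events C" and k: "Ew \<noteq> Er" "k \<in> range_w Ew" "k \<in> range_r Er"
    using C(2) rbf by (auto simp: well_formed_def wf_rbf_def)
  have "(Ew, Er) \<in> rf C"
    using rbf by (auto simp: rf_def)
  have "k \<in> range_ev Ew" "k \<in> range_ev Er"
    using k by (auto simp: range_ev_def)
  moreover have "is_write Ew \<or> is_write Er"
    using k(2) is_write_if_in_range_w by blast
  ultimately consider (hb) "(Ew, Er) \<in> hb C \<or> (Er, Ew) \<in> hb C"
    | (SeqCst) "ord Ew = SeqCst" "ord Er = SeqCst" "range_ev Ew = range_ev Er"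
    by (rule conflict_cases[OF C E k(1)])
  then show ?thesis
  proof cases
    \<comment> \<open>\<open>HB2\<close> rules out the reverse direction.\<close>
    case hb
    with \<open>HB2 C\<close> \<open>(Ew, Er) \<in> rf C\<close> show ?thesis
      by (auto simp: HB2_def)
  next
    case SeqCst
    then have "(Ew, Er) \<in> sw C"
      using \<open>(Ew, Er) \<in> rf C\<close> range_w_eq_range_ev[OF wfe E(1) k(2)]
        range_r_eq_range_ev[OF wfe E(2) k(3)] by (simp add: sw_def)
    then show ?thesis
      using sw_subset_hb by blast
  qed
qed

lemma no_intervening_write:
  assumes C: "candidate_execution C" "well_formed C" "valid_revised C" "data_race_free C"
    and rbf: "(k, Ew, Er) \<in> rbf C"
    and W: "W \<in> evs C" "k \<in> range_w W"
    and tot: "(Ew, W) \<in> tot C" "(W, Er) \<in> tot C"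
  shows False
proof -
  have E: "Ew \<in> evs C" "Er \<in> evs C"
    using C(1) rbf unfolding candidate_execution_def by blast+
  have wfe: "wf_events C" and k: "k \<in> range_w Ew" "k \<in> range_r Er"
    and lin: "trans (tot C)" "irrefl (tot C)"
    using C(2) rbf by (auto simp: well_formed_def wf_rbf_def strict_total_order_def
        strict_linear_order_on_def)
  have HB: "HB1 C" "HB2 C" "HB3 C" and sc: "sc_atomics C"
    using C(3) by (auto simp: valid_revised_def)
  \<comment> \<open>SC Atomics constrains only those \<open>rf\<close> pairs that are also
    hb-ordered.\<close>
  have hb: "(Ew, Er) \<in> hb C"
    using rbf_hb C HB(2) rbf by blast
  have rf: "(Ew, Er) \<in> rf C"
    using rbf by (auto simp: rf_def)
  have wr: "is_write W"
    using W(2) by (rule is_write_if_in_range_w)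
  \<comment> \<open>By \<open>HB1\<close>, an hb edge against the \<open>tot\<close> order would
    close a cycle in \<open>tot\<close>.\<close>
  have ne: "Ew \<noteq> W" "W \<noteq> Er" and nhb: "(W, Ew) \<notin> hb C" "(Er, W) \<notin> hb C"
    using tot lin HB(1) by (auto simp: HB1_def irrefl_def dest: transD)
  have rng: "range_w Ew = range_ev Ew" "range_w W = range_ev W" "range_r Er = range_ev Er"
    using range_w_eq_range_ev[OF wfe] range_r_eq_range_ev[OF wfe] E W k by simp_all
  have kev: "k \<in> range_ev Ew" "k \<in> range_ev W" "k \<in> range_ev Er"
    using k W rng by auto
  have first: "(Ew, W) \<in> hb C \<or>
      ord Ew = SeqCst \<and> ord W = SeqCst \<and> range_w Ew = range_w W"
    using conflict_cases[OF C(1,2,4) E(1) W(1) ne(1) kev(1,2)] wr nhb(1) rng(1,2)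
    by auto
  have second: "(W, Er) \<in> hb C \<or>
      ord W = SeqCst \<and> ord Er = SeqCst \<and> range_w W = range_r Er"
    using conflict_cases[OF C(1,2,4) W(1) E(2) ne(2) kev(2,3)] wr nhb(2) rng(2,3)
    by auto
  \<comment> \<open>Clauses (a), (b), (c). The premise on \<open>W\<close> holds as soon as one of
    its two pairs is hb-unordered.\<close>
  have atomics: "\<not> (range_w W = range_r Er \<and> (Ew, Er) \<in> sw C)"
    "\<not> (range_w Ew = range_w W \<and> ord Ew = SeqCst \<and> (W, Er) \<in> hb C)"
    "\<not> (range_w W = range_r Er \<and> (Ew, W) \<in> hb C \<and> ord Er = SeqCst)"
    if "ord W = SeqCst"
    using sc rf hb W(1) wr that tot by (auto simp: sc_atomics_def)
  have "\<not> ((Ew, W) \<in> hb C \<and> (W, Er) \<in> hb C)"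
    using HB(3) rbf W wr unfolding HB3_def by blast
  \<comment> \<open>Needed for clause (a): if both pairs are hb-unordered, the range equalities
    chain through \<open>W\<close>.\<close>
  moreover have "(Ew, Er) \<in> sw C"
    if "ord Ew = SeqCst" "ord Er = SeqCst" "range_w Ew = range_r Er"
    using that rf by (simp add: sw_def)
  ultimately show False
    using first second atomics by metis
qed

theorem theorem6p1:
  fixes C :: "('i, 'b) candidate"
  assumes "candidate_execution C"
    and "well_formed C"
    and "valid_revised C"
    and "data_race_free C"
  shows "sequentially_consistent C"
proof -
  have HB: "HB1 C" "HB2 C"
    using assms(3) by (auto simp: valid_revised_def)
  have "strict_total_order (evs C) (tot C)"
    using assms(2) by (simp add: well_formed_def)
  moreover have "sb C \<union> asw C \<subseteq> tot C"
    using HB(1) by (auto simp: HB1_def hb_def sw_def)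
  moreover have "(Ew, Er) \<in> tot C" if "(k, Ew, Er) \<in> rbf C" for k Ew Er
    using rbf_hb[OF assms(1,2,4) HB(2) that] HB(1) by (auto simp: HB1_def)
  ultimately show ?thesis
    using no_intervening_write[OF assms] unfolding sequentially_consistent_def
    by (intro exI[of _ "tot C"] conjI allI impI notI) auto
qed

end
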